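(* Let $N\in\mathbb{N}$ and $K\in\mathbb{N}$ with $K\geq 2$ and $N\leq K$. Then for every $t\in\{0,1,\ldots,K\}$ the memory–rate pair $$(M,R)=\left(\frac{t[(N-1)t+K-N]}{K(K-1)},\ \frac{N(K-t)}{K}\right)$$ is achievable for the caching problem with $N$ files and $K$ users.
   Context: The caching problem with $N$ files and $K$ users: a server holds $N$ independent files $W_1,\ldots,W_N$, each uniformly distributed over $F$ bits. There are $K$ users, each with a cache. A caching scheme with cache size $M$ and rate $R$ consists of: (i) caching functions $\phi_k$, $k=1,\ldots,K$, mapping $(W_1,\ldots,W_N)$ to a cache content $Z_k=\phi_k(W_1,\ldots,W_N)$ of at most $\lfloor MF\rfloor$ bits (chosen without knowledge of the later demands); (ii) for each demand vector $d=(d_1,\ldots,d_K)\in\{1,\ldots,N\}^K$ (user $k$ requests file $W_{d_k}$), an encoding function $\psi_d$ producing a common broadcast message $X_d=\psi_d(W_1,\ldots,W_N)$ of at most $\lfloor RF\rfloor$ bits; (iii) decoding functions $\mu_{d,k}$ with user $k$ forming the estimate $\hat W_{d,k}=\mu_{d,k}(X_d,Z_k)$ of $W_{d_k}$. A pair $(M,R)$ is achievable if for every $\epsilon>0$ and every sufficiently large $F$ there exists a caching scheme with cache size $M$ and rate $R$ such that $\max_{d}\max_{k}\Pr(\hat W_{d,k}\neq W_{d_k})\leq\epsilon$. Both $M$ and $R$ are measured in multiples of the file size $F$. *)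

theory Defs
  imports Complex_Main "HOL-Library.FuncSet"
begin

text \<open>Files are indexed 0..<N, users 0..<K. A file is a bit string (bool list) of
length F. The N independent uniform files form a tuple W drawn uniformly from
file_tuples N F; probabilities are therefore relative counts.\<close>

definition file_tuples :: "nat \<Rightarrow> nat \<Rightarrow> (nat \<Rightarrow> bool list) set" where
  "file_tuples N F = PiE {..<N} (\<lambda>_. {xs :: bool list. length xs = F})"

definition demands :: "nat \<Rightarrow> nat \<Rightarrow> (nat \<Rightarrow> nat) set" where
  "demands N K = PiE {..<K} (\<lambda>_. {..<N})"

definition error_prob ::
  "nat \<Rightarrow> nat \<Rightarrow> (nat \<Rightarrow> (nat \<Rightarrow> bool list) \<Rightarrow> bool list)
   \<Rightarrow> ((nat \<Rightarrow> nat) \<Rightarrow> (nat \<Rightarrow> bool list) \<Rightarrow> bool list)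
   \<Rightarrow> ((nat \<Rightarrow> nat) \<Rightarrow> nat \<Rightarrow> bool list \<Rightarrow> bool list \<Rightarrow> bool list)
   \<Rightarrow> (nat \<Rightarrow> nat) \<Rightarrow> nat \<Rightarrow> real" where
  "error_prob N F phi psi mu d k =
     real (card {W \<in> file_tuples N F. mu d k (psi d W) (phi k W) \<noteq> W (d k)})
     / real (card (file_tuples N F))"

text \<open>A caching scheme with N files, K users, file size F, cache size M, rate R:
  caching functions phi k (independent of demands), encoding functions psi d,
  decoding functions mu d k; cache contents have at most floor(M F) bits and
  broadcast messages at most floor(R F) bits.\<close>
definition caching_scheme ::
  "nat \<Rightarrow> nat \<Rightarrow> nat \<Rightarrow> real \<Rightarrow> real
   \<Rightarrow> (nat \<Rightarrow> (nat \<Rightarrow> bool list) \<Rightarrow> bool list)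
   \<Rightarrow> ((nat \<Rightarrow> nat) \<Rightarrow> (nat \<Rightarrow> bool list) \<Rightarrow> bool list)
   \<Rightarrow> ((nat \<Rightarrow> nat) \<Rightarrow> nat \<Rightarrow> bool list \<Rightarrow> bool list \<Rightarrow> bool list) \<Rightarrow> bool" where
  "caching_scheme N K F M R phi psi mu \<longleftrightarrow>
     (\<forall>k<K. \<forall>W\<in>file_tuples N F. real (length (phi k W)) \<le> of_int \<lfloor>M * real F\<rfloor>) \<and>
     (\<forall>d\<in>demands N K. \<forall>W\<in>file_tuples N F. real (length (psi d W)) \<le> of_int \<lfloor>R * real F\<rfloor>)"

definition achievable :: "nat \<Rightarrow> nat \<Rightarrow> real \<Rightarrow> real \<Rightarrow> bool" where
  "achievable N K M R \<longleftrightarrow>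
     (\<forall>\<epsilon>>0. \<exists>F0. \<forall>F\<ge>F0. \<exists>phi psi mu.
        caching_scheme N K F M R phi psi mu \<and>
        (\<forall>d\<in>demands N K. \<forall>k<K. error_prob N F phi psi mu d k \<le> \<epsilon>))"

end

theory Submission
  imports Defs "HOL-Library.Function_Algebras" "HOL-Number_Theory.Cong"
begin

text \<open>Split every file into one subfile \<open>W\<^bsub>n,T\<^esub>\<close> for each \<open>t\<close>-set \<open>T\<close> of users; user \<open>k\<close> caches
  generic linear combinations of the subfiles with \<open>k \<in> T\<close>.  When every file is requested, each
  file \<open>n\<close> gets a leader \<open>\<sigma> n\<close> among the set \<open>P n\<close> of its requesters, and for each \<open>T\<close> with
  \<open>\<sigma> n \<notin> T\<close> the server sends the sum of the \<open>W\<^bsub>n,S\<^esub>\<close> with \<open>S = (T \<union> {\<sigma> n}) - {j}\<close>, \<open>j \<in> P n\<close>.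
  For a user that does not want \<open>n\<close>, the transmissions with \<open>k \<in> T\<close> involve only subfiles that it
  caches, so together with the cache they eliminate the interference; the rest is peeled off.
  If some files are not requested, surplus users virtually request them, and for each \<open>T\<close> the labels
  of the files are permuted so that the virtual requesters still obtain the file they want.

  The scheme is linear over the rationals.  After clearing denominators by some \<open>D\<close> it works over
  the integers modulo every \<open>q\<close> coprime to \<open>D\<close>.  With \<open>s\<close> subfiles per file, such a \<open>q\<close> can be
  taken so close to \<open>2 powr (F / s)\<close> from below that all but a fraction \<open>\<epsilon>\<close> of the files are
  encoded faithfully by \<open>s\<close> symbols.\<close>


section \<open>Linear algebra over an infinite field: one complement for finitely many
  subspaces\<close>

context vector_space
begin

text \<open>No finite family of proper subspaces covers a space over an infinite field. If the
  vector \<open>z\<close> found for \<open>I\<close> lies in \<open>S a\<close>, move along the line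
  \<open>w + c *s z\<close> with \<open>w\<close> outside \<open>S a\<close>: this line misses
  \<open>S a\<close> and meets each other \<open>S i\<close> at most once, since two meeting points
  would put \<open>z\<close> into \<open>S i\<close>.\<close>

lemma subspace_avoid_finite:
  assumes inf: "infinite (UNIV :: 'a set)" and "finite I" and V: "subspace V"
    and "\<And>i. i \<in> I \<Longrightarrow> subspace (S i)" and "\<And>i. i \<in> I \<Longrightarrow> \<not> V \<subseteq> S i"
  shows "\<exists>z\<in>V. \<forall>i\<in>I. z \<notin> S i"
  using assms(2,4,5)
proof (induction I rule: finite_induct)
  case empty
  then show ?case using subspace_0[OF V] by blast
next
  case (insert a I)
  then obtain z where z: "z \<in> V" "\<forall>i\<in>I. z \<notin> S i" by auto
  show ?case
  proof (cases "z \<in> S a")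
    case False
    then show ?thesis using z by auto
  next
    case True
    obtain w where w: "w \<in> V" "w \<notin> S a" using insert.prems(2)[of a] by auto
    have sub: "subspace (S i)" if "i \<in> insert a I" for i using that insert.prems by auto
    define Bad where "Bad i = {c. w + c *s z \<in> S i}" for i
    have fin: "finite (Bad i)" if i: "i \<in> I" for i
    proof -
      have "c = c'" if "c \<in> Bad i" "c' \<in> Bad i" for c c'
      proof (rule ccontr)
        assume ne: "c \<noteq> c'"
        have "(w + c *s z) - (w + c' *s z) \<in> S i"
          using that sub[of i] i unfolding Bad_def by (intro subspace_diff) auto
        then have "(c - c') *s z \<in> S i" by (simp add: scale_left_diff_distrib)
        then have "inverse (c - c') *s ((c - c') *s z) \<in> S i"
          using subspace_scale[OF sub[of i]] i by blast
        moreover have "inverse (c - c') *s ((c - c') *s z) = z"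
          using ne by (simp only: scale_scale) simp
        ultimately show False using z i by simp
      qed
      then have "\<exists>c0. Bad i \<subseteq> {c0}" by blast
      then show ?thesis using finite_subset by blast
    qed
    obtain c where c: "c \<notin> (\<Union>i\<in>I. Bad i)"
      using ex_new_if_finite[OF inf, of "\<Union>i\<in>I. Bad i"] fin insert.hyps by auto
    have "w + c *s z \<notin> S a"
    proof
      assume "w + c *s z \<in> S a"
      then have "(w + c *s z) - c *s z \<in> S a"
        using True sub[of a] by (intro subspace_diff subspace_scale) auto
      then show False using w by simp
    qed
    then show ?thesis using c z w V unfolding Bad_def
      by (intro bexI[of _ "w + c *s z"]) (auto intro: subspace_add subspace_scale)
  qed
qed

text \<open>Steinitz exchange: some vector of \<open>C\<close> is needed to express
  \<open>z\<close>, and the relation can be solved for that vector. The induction discards vectors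
  of \<open>C\<close> until it meets one without which \<open>z\<close> leaves the span.\<close>

lemma span_exchange_finite:
  assumes "finite C" "z \<in> span (U \<union> C)" "z \<notin> span U"
  shows "\<exists>c\<in>C. c \<in> span (insert z (U \<union> (C - {c})))"
  using assms
proof (induction C rule: finite_induct)
  case empty
  then show ?case by simp
next
  case (insert c C)
  show ?case
  proof (cases "z \<in> span (U \<union> C)")
    case True
    then obtain c' where c': "c' \<in> C" "c' \<in> span (insert z (U \<union> (C - {c'})))"
      using insert by blast
    have "insert z (U \<union> (C - {c'})) \<subseteq> insert z (U \<union> (insert c C - {c'}))" by auto
    then show ?thesis using c' span_mono by blast
  next
    case False
    have "c \<in> span (insert z (U \<union> C))"
      using in_span_insert[of z c "U \<union> C"] insert.prems False by simp
    moreover have "insert z (U \<union> C) = insert z (U \<union> (insert c C - {c}))"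
      using insert.hyps by auto
    ultimately show ?thesis by auto
  qed
qed

text \<open>Makes the cache independent of the demand: if \<open>r\<close> vectors suffice for each
  index separately, some \<open>r\<close> vectors suffice for all at once. A vector \<open>z\<close>
  of \<open>V\<close> outside every span that still misses part of \<open>V\<close> lowers all the
  deficits together.\<close>

lemma common_complement:
  assumes inf: "infinite (UNIV :: 'a set)" and I: "finite I" and V: "subspace V"
    and "\<And>i. i \<in> I \<Longrightarrow> \<exists>C. finite C \<and> card C \<le> r \<and> V \<subseteq> span (U i \<union> C)"
  shows "\<exists>Z. Z \<subseteq> V \<and> finite Z \<and> card Z \<le> r \<and> (\<forall>i\<in>I. V \<subseteq> span (U i \<union> Z))"
  using assms(4)
proof (induction r arbitrary: U)
  case 0
  then show ?case by (intro exI[of _ "{}"]) fastforce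
next
  case (Suc r)
  define J where "J = {i \<in> I. \<not> V \<subseteq> span (U i)}"
  have "\<exists>z\<in>V. \<forall>i\<in>J. z \<notin> span (U i)"
    by (rule subspace_avoid_finite[OF inf _ V]) (use I in \<open>auto simp: J_def\<close>)
  then obtain z where z: "z \<in> V" "\<forall>i\<in>J. z \<notin> span (U i)" by blast
  \<comment> \<open>An index outside \<open>J\<close> has no deficit left; for an index in
    \<open>J\<close>, exchanging \<open>z\<close> for some \<open>c\<close> of \<open>C\<close>
    saves one vector.\<close>
  have "\<exists>C. finite C \<and> card C \<le> r \<and> V \<subseteq> span (insert z (U i) \<union> C)" if i: "i \<in> I" for i
  proof (cases "i \<in> J")
    case False
    then have "V \<subseteq> span (U i)" using i unfolding J_def by auto
    also have "\<dots> \<subseteq> span (insert z (U i) \<union> {})" by (intro span_mono) auto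
    finally show ?thesis by (intro exI[of _ "{}"]) simp
  next
    case True
    obtain C where C: "finite C" "card C \<le> Suc r" "V \<subseteq> span (U i \<union> C)"
      using Suc.prems[OF i] by blast
    obtain c where c: "c \<in> C" "c \<in> span (insert z (U i \<union> (C - {c})))"
      using span_exchange_finite[of C z "U i"] C z True by auto
    have "U i \<union> C \<subseteq> insert c (insert z (U i) \<union> (C - {c}))" by blast
    also have "\<dots> \<subseteq> span (insert z (U i) \<union> (C - {c}))"
      using c(2) span_superset[of "insert z (U i) \<union> (C - {c})"] by simp
    finally have "U i \<union> C \<subseteq> span (insert z (U i) \<union> (C - {c}))" .
    then have "span (U i \<union> C) \<subseteq> span (insert z (U i) \<union> (C - {c}))"
      by (rule span_minimal) simp
    then show ?thesis using C c by (intro exI[of _ "C - {c}"]) auto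
  qed
  then have "\<exists>Z. Z \<subseteq> V \<and> finite Z \<and> card Z \<le> r \<and> (\<forall>i\<in>I. V \<subseteq> span (insert z (U i) \<union> Z))"
    by (rule Suc.IH)
  then obtain Z where Z: "Z \<subseteq> V" "finite Z" "card Z \<le> r" "\<forall>i\<in>I. V \<subseteq> span (insert z (U i) \<union> Z)"
    by blast
  show ?case
    using Z z by (intro exI[of _ "insert z Z"]) (auto simp: card_insert_if)
qed

end

section \<open>The rational vector space of combinations of subfiles\<close>

text \<open>Rational scalars provide the infinite field over which generic combinations exist; the
  argument type will be the index set of the subfiles.\<close>

definition scale_fun :: "rat \<Rightarrow> ('a \<Rightarrow> rat) \<Rightarrow> 'a \<Rightarrow> rat" where
  "scale_fun c f = (\<lambda>x. c * f x)"

interpretation fv: vector_space scale_fun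
  by unfold_locales (auto simp: scale_fun_def fun_eq_iff algebra_simps)

definition unit_vec :: "'a \<Rightarrow> 'a \<Rightarrow> rat" where
  "unit_vec p = (\<lambda>x. if x = p then 1 else 0)"

lemma sum_fun_apply: "(\<Sum>i\<in>A. f i) x = (\<Sum>i\<in>A. f i x)" for f :: "'i \<Rightarrow> 'a \<Rightarrow> rat"
  by (induction A rule: infinite_finite_induct) auto

text \<open>The elementary decoding step: a transmitted sum with all terms but one known reveals the
  last one.\<close>

lemma span_sum_remove:
  assumes "finite A" "j \<in> A" "(\<Sum>i\<in>A. f i) \<in> fv.span S" "\<And>i. i \<in> A - {j} \<Longrightarrow> f i \<in> fv.span S"
  shows "f j \<in> fv.span S"
proof -
  have "f j = (\<Sum>i\<in>A. f i) - (\<Sum>i\<in>A - {j}. f i)"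
    using assms(1,2) by (simp add: sum.remove)
  moreover have "(\<Sum>i\<in>A - {j}. f i) \<in> fv.span S"
    using assms(4) by (rule fv.span_sum)
  ultimately show ?thesis using assms(3) fv.span_diff by metis
qed

section \<open>Combinatorics of the users: \<open>t\<close>-subsets and virtual demands\<close>

definition t_subsets :: "nat \<Rightarrow> nat \<Rightarrow> nat set set" where
  "t_subsets K t = {T. T \<subseteq> {..<K} \<and> card T = t}"

lemma finite_t_subsets [simp]: "finite (t_subsets K t)"
  unfolding t_subsets_def by (rule finite_subset[of _ "Pow {..<K}"]) auto

lemma card_t_subsets: "card (t_subsets K t) = K choose t"
  unfolding t_subsets_def using n_subsets[of "{..<K}" t] by simp

lemma finite_of_t_subsets: "T \<in> t_subsets K t \<Longrightarrow> finite T"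
  unfolding t_subsets_def using finite_subset by blast

lemma t_subsets_exchange:
  assumes "T \<in> t_subsets K t" "l < K" "l \<notin> T" "j \<in> insert l T"
  shows "insert l T - {j} \<in> t_subsets K t"
proof -
  have "finite T" using assms(1) by (rule finite_of_t_subsets)
  then show ?thesis using assms unfolding t_subsets_def by (auto simp: card_insert_if card_Diff_singleton_if)
qed

lemma card_t_subsets_notin:
  assumes "l < K"
  shows "card {T \<in> t_subsets K t. l \<notin> T} = (K - 1) choose t"
proof -
  have "{T \<in> t_subsets K t. l \<notin> T} = {T. T \<subseteq> {..<K} - {l} \<and> card T = t}"
    unfolding t_subsets_def by auto
  then show ?thesis using n_subsets[of "{..<K} - {l}" t] assms by simp
qed

text \<open>Removing \<open>L\<close> leaves a free choice among the other users. The case split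
  guards against truncated subtraction, which would give a binomial coefficient 1 when
  \<open>L\<close> is too large.\<close>

lemma card_supersets:
  assumes "L \<subseteq> {..<K}"
  shows "card {T \<in> t_subsets K t. L \<subseteq> T} = (if card L \<le> t then (K - card L) choose (t - card L) else 0)"
proof (cases "card L \<le> t")
  case True
  have finL: "finite L" using assms finite_subset by blast
  have "bij_betw (\<lambda>T. T \<union> L) {T. T \<subseteq> {..<K} - L \<and> card T = t - card L} {T \<in> t_subsets K t. L \<subseteq> T}"
  proof (rule bij_betw_byWitness[where f' = "\<lambda>T. T - L"])
    show "(\<lambda>T. T \<union> L) ` {T. T \<subseteq> {..<K} - L \<and> card T = t - card L} \<subseteq> {T \<in> t_subsets K t. L \<subseteq> T}"
    proof safe
      fix T assume T: "T \<subseteq> {..<K} - L" "card T = t - card L"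
      have "finite T" using T finite_subset by blast
      moreover have "T \<inter> L = {}" using T by blast
      ultimately have "card (T \<union> L) = t" using finL T True by (simp add: card_Un_disjoint)
      then show "T \<union> L \<in> t_subsets K t" using T assms unfolding t_subsets_def by blast
    qed
    show "(\<lambda>T. T - L) ` {T \<in> t_subsets K t. L \<subseteq> T} \<subseteq> {T. T \<subseteq> {..<K} - L \<and> card T = t - card L}"
    proof safe
      fix T assume T: "T \<in> t_subsets K t" "L \<subseteq> T"
      then show "card (T - L) = t - card L"
        using finL by (simp add: t_subsets_def card_Diff_subset)
    qed (auto simp: t_subsets_def)
  qed auto
  then have "card {T \<in> t_subsets K t. L \<subseteq> T} = card {T. T \<subseteq> {..<K} - L \<and> card T = t - card L}"
    by (rule bij_betw_same_card[symmetric])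
  also have "\<dots> = (K - card L) choose (t - card L)"
    using n_subsets[of "{..<K} - L"] assms finL by (simp add: card_Diff_subset)
  finally show ?thesis using True by simp
next
  case False
  have "\<not> L \<subseteq> T" if "T \<in> t_subsets K t" for T
    using card_mono[OF finite_of_t_subsets[OF that], of L] that False
    unfolding t_subsets_def by auto
  then have "{T \<in> t_subsets K t. L \<subseteq> T} = {}" by blast
  then show ?thesis using False by simp
qed

text \<open>A file that nobody requests is given to a surplus user, who virtually demands it.\<close>

lemma virtual_demand_exists:
  assumes d: "d \<in> demands N K" and "N \<le> K"
  shows "\<exists>\<sigma> b. (\<forall>n<N. \<sigma> n < K \<and> b (\<sigma> n) = n) \<and>
    (\<forall>k<K. b k < N \<and> (b k = d k \<or> b k \<notin> d ` {..<K} \<and> \<sigma> (b k) = k))"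
proof -
  define Q where "Q = d ` {..<K}"
  define s where "s = inv_into {..<K} d"
  have QN: "Q \<subseteq> {..<N}" using d unfolding Q_def demands_def by auto
  have s: "s n < K" "d (s n) = n" if "n \<in> Q" for n
    using that inv_into_into[of n d "{..<K}"] f_inv_into_f[of n d "{..<K}"]
    unfolding Q_def s_def by auto
  have finQ: "finite Q" unfolding Q_def by simp
  have injs: "inj_on s Q" using s(2) by (metis inj_onI)
  have sQ: "s ` Q \<subseteq> {..<K}" using s(1) by auto
  have "card ({..<N} - Q) = N - card Q" using QN finQ by (simp add: card_Diff_subset)
  moreover have "card ({..<K} - s ` Q) = K - card Q"
    using sQ finQ injs by (simp add: card_Diff_subset card_image)
  \<comment> \<open>After one requester \<open>s n\<close> is set aside for each requested file,
    \<open>N \<le> K\<close> leaves enough users for the unrequested files.\<close>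
  ultimately have "card ({..<N} - Q) \<le> card ({..<K} - s ` Q)" using \<open>N \<le> K\<close> by simp
  then obtain f where f: "f ` ({..<N} - Q) \<subseteq> {..<K} - s ` Q" "inj_on f ({..<N} - Q)"
    using card_le_inj[of "{..<N} - Q" "{..<K} - s ` Q"] by auto
  define \<sigma> where "\<sigma> n = (if n \<in> Q then s n else f n)" for n
  define b where "b k = (if k \<in> f ` ({..<N} - Q) then inv_into ({..<N} - Q) f k else d k)" for k
  have "\<sigma> n < K \<and> b (\<sigma> n) = n" if "n < N" for n
  proof (cases "n \<in> Q")
    case True
    then have "s n \<notin> f ` ({..<N} - Q)" using f(1) by blast
    then show ?thesis using True s by (simp add: \<sigma>_def b_def)
  next
    case False
    then have "n \<in> {..<N} - Q" using that by simp
    then show ?thesis using False f by (auto simp: \<sigma>_def b_def)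
  qed
  moreover have "b k < N \<and> (b k = d k \<or> b k \<notin> Q \<and> \<sigma> (b k) = k)" if "k < K" for k
  proof (cases "k \<in> f ` ({..<N} - Q)")
    case True
    then have "b k \<in> {..<N} - Q" "f (b k) = k"
      using inv_into_into[OF True] f_inv_into_f[OF True] by (auto simp: b_def)
    then show ?thesis by (auto simp: \<sigma>_def)
  next
    case False
    then show ?thesis using that QN by (auto simp: b_def Q_def)
  qed
  ultimately show ?thesis unfolding Q_def by blast
qed

section \<open>Delivery and placement over the rationals\<close>

text \<open>The subfiles that placement assigns to user \<open>k\<close>. The cache will hold
  combinations from their span, enough to recover all of them with the help of any demand's
  transmissions.\<close>

definition star :: "nat \<Rightarrow> nat \<Rightarrow> nat \<Rightarrow> nat \<Rightarrow> (nat \<times> nat set \<Rightarrow> rat) set" where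
  "star N K t k = unit_vec ` {(n, T). n < N \<and> T \<in> t_subsets K t \<and> k \<in> T}"

text \<open>For user \<open>k\<close>, the set \<open>C\<close> keeps the subfiles of its virtually
  demanded file with \<open>k\<close> in \<open>T\<close>, and for each other file those with both
  \<open>k\<close> and the leader in \<open>T\<close>; the transmissions \<open>U\<close> supply the
  rest of \<open>star\<close>. Here \<open>C\<close> may still depend on the demand.\<close>

lemma delivery_exists:
  assumes d: "d \<in> demands N K" and NK: "N \<le> K"
  shows "\<exists>U. finite U \<and> card U \<le> N * ((K - 1) choose t) \<and> (\<forall>k<K.
     (\<exists>C. finite C \<and> card C \<le> card {T \<in> t_subsets K t. {k} \<subseteq> T} +
            (N - 1) * (if 2 \<le> t then (K - 2) choose (t - 2) else 0) \<and>
          star N K t k \<subseteq> fv.span (U \<union> C)) \<and>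
     (\<forall>T\<in>t_subsets K t. unit_vec (d k, T) \<in> fv.span (U \<union> star N K t k)))"
proof -
  let ?TT = "t_subsets K t"
  obtain \<sigma> b where \<sigma>: "\<And>n. n < N \<Longrightarrow> \<sigma> n < K" and b\<sigma>: "\<And>n. n < N \<Longrightarrow> b (\<sigma> n) = n"
    and bN: "\<And>k. k < K \<Longrightarrow> b k < N"
    and bd: "\<And>k. k < K \<Longrightarrow> b k = d k \<or> b k \<notin> d ` {..<K} \<and> \<sigma> (b k) = k"
    using virtual_demand_exists[OF assms] by blast
  have dN: "d k < N" if "k < K" for k using d that unfolding demands_def by auto
  define P where "P n = {k. k < K \<and> b k = n}" for n
  \<comment> \<open>An unrequested file has its leader as only virtual requester, so each of its
    transmissions is a single subfile.\<close>
  have P_missing: "P n = {\<sigma> n}" if "n < N" "n \<notin> d ` {..<K}" for n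
  proof -
    have "b k \<noteq> n" if "k \<noteq> \<sigma> n" "k < K" for k
      using bd[OF that(2)] that \<open>n \<notin> d ` {..<K}\<close> by auto
    then show ?thesis using \<sigma> b\<sigma> \<open>n < N\<close> unfolding P_def by blast
  qed
  \<comment> \<open>Candidates for carrying the subfile of \<open>g\<close> at \<open>T\<close>:
    unrequested files whose leader really wants \<open>g\<close> and lies outside \<open>T\<close>.
    The map \<open>\<pi> T\<close> swaps \<open>g\<close> with one candidate, if there is any, so
    that this subfile is sent uncombined.\<close>
  define H where "H g T = {m. m < N \<and> m \<notin> d ` {..<K} \<and> d (\<sigma> m) = g \<and> \<sigma> m \<notin> T}" for g T
  define c where "c g T = (if H g T = {} then g else (SOME m. m \<in> H g T))" for g T
  have cH: "c g T < N \<and> c g T \<notin> d ` {..<K} \<and> d (\<sigma> (c g T)) = g \<and> \<sigma> (c g T) \<notin> T"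
    if "H g T \<noteq> {}" for g T
  proof -
    have "c g T \<in> H g T" using that some_in_eq unfolding c_def by auto
    then show ?thesis by (simp add: H_def)
  qed
  have c0: "c g T = g" if "H g T = {}" for g T
    using that by (simp add: c_def)
  define \<pi> where "\<pi> T n = (if n \<in> d ` {..<K} then c n T
      else if c (d (\<sigma> n)) T = n then d (\<sigma> n) else n)" for T n
  have \<pi>N: "\<pi> T n < N" if n: "n < N" for T n
  proof -
    have "c n T < N" using cH[of n T] c0[of n T] n by (cases "H n T = {}") auto
    moreover have "d (\<sigma> n) < N" using dN[OF \<sigma>[OF n]] .
    ultimately show ?thesis using n by (simp add: \<pi>_def)
  qed
  \<comment> \<open>The swaps are disjoint, because a candidate \<open>m\<close> determines
    \<open>g\<close> as \<open>d (\<sigma> m)\<close>; hence \<open>\<pi> T\<close> is an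
    involution.\<close>
  have \<pi>\<pi>: "\<pi> T (\<pi> T n) = n" if n: "n < N" for T n
  proof (cases "n \<in> d ` {..<K}")
    case True
    then have *: "\<pi> T n = c n T" by (simp add: \<pi>_def)
    show ?thesis
    proof (cases "H n T = {}")
      case True
      then show ?thesis using * c0 by simp
    next
      case False
      show ?thesis unfolding * using cH[OF False] by (simp add: \<pi>_def)
    qed
  next
    case False
    have g: "d (\<sigma> n) \<in> d ` {..<K}" using \<sigma>[OF n] by simp
    show ?thesis
    proof (cases "c (d (\<sigma> n)) T = n")
      case True
      then have "\<pi> T n = d (\<sigma> n)" using False by (simp add: \<pi>_def)
      then show ?thesis using g True by (simp add: \<pi>_def)
    next
      case ne: False
      then show ?thesis using False by (simp add: \<pi>_def)
    qed
  qed
  define x where "x n T = unit_vec (\<pi> T n, T)" for n T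
  have unit_x: "unit_vec (n, T) = x (\<pi> T n) T" if "n < N" for n T
    using \<pi>\<pi>[OF that] by (simp add: x_def)
  \<comment> \<open>Term \<open>j\<close> carries the index set from which requester
    \<open>j\<close> is missing; the term for the leader has index set \<open>T\<close> when
    \<open>\<sigma> n \<notin> T\<close>.\<close>
  define y where "y n T = (\<Sum>j\<in>insert (\<sigma> n) T \<inter> P n. x n (insert (\<sigma> n) T - {j}))" for n T
  define U where "U = (\<lambda>(n, T). y n T) ` (SIGMA n:{..<N}. {T \<in> ?TT. \<sigma> n \<notin> T})"
  have finU: "finite U" unfolding U_def by (intro finite_imageI finite_SigmaI) auto
  have cardU: "card U \<le> N * ((K - 1) choose t)"
  proof -
    have "card U \<le> card (SIGMA n:{..<N}. {T \<in> ?TT. \<sigma> n \<notin> T})"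
      unfolding U_def by (intro card_image_le finite_SigmaI) auto
    also have "\<dots> = (\<Sum>n<N. card {T \<in> ?TT. \<sigma> n \<notin> T})"
      by (rule card_SigmaI) auto
    also have "\<dots> = N * ((K - 1) choose t)"
      using \<sigma> by (simp add: card_t_subsets_notin)
    finally show ?thesis .
  qed
  have yU: "y n T \<in> U" if "n < N" "T \<in> ?TT" "\<sigma> n \<notin> T" for n T
    using that unfolding U_def by force
  have finA: "finite (insert (\<sigma> n) T \<inter> P n)" for n T
    unfolding P_def by (rule finite_subset[of _ "{..<K}"]) auto
  have \<sigma>P: "\<sigma> n \<in> P n" if "n < N" for n
    using \<sigma> b\<sigma> that unfolding P_def by auto
  have x_star: "x n T \<in> star N K t k" if "n < N" "T \<in> ?TT" "k \<in> T" for n T k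
    using that \<pi>N unfolding x_def star_def by auto
  show ?thesis
  proof (rule exI[of _ U], intro conjI allI impI ballI)
    fix k assume k: "k < K"
    \<comment> \<open>For \<open>n = b k\<close> the pair collapses to \<open>{k}\<close>, so the
      user's own virtual file is counted with all \<open>T\<close> containing
      \<open>k\<close>.\<close>
    define I where "I = (SIGMA n:{..<N}. {T \<in> ?TT. {k, if n = b k then k else \<sigma> n} \<subseteq> T})"
    define C where "C = (\<lambda>(n, T). x n T) ` I"
    have finI: "finite I" unfolding I_def by (intro finite_SigmaI) auto
    have "card C \<le> card I" unfolding C_def using finI by (rule card_image_le)
    also have "card I = (\<Sum>n<N. card {T \<in> ?TT. {k, if n = b k then k else \<sigma> n} \<subseteq> T})"
      unfolding I_def by (rule card_SigmaI) auto
    also have "\<dots> = card {T \<in> ?TT. {k} \<subseteq> T} + (\<Sum>n\<in>{..<N} - {b k}. card {T \<in> ?TT. {k, \<sigma> n} \<subseteq> T})"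
      using bN[OF k] by (subst sum.remove[of _ "b k"]) auto
    also have "(\<Sum>n\<in>{..<N} - {b k}. card {T \<in> ?TT. {k, \<sigma> n} \<subseteq> T})
      = (\<Sum>n\<in>{..<N} - {b k}. (if 2 \<le> t then (K - 2) choose (t - 2) else 0))"
    proof (rule sum.cong[OF refl])
      fix n assume n: "n \<in> {..<N} - {b k}"
      then have "\<sigma> n \<noteq> k" using b\<sigma> by auto
      then have "card {k, \<sigma> n} = 2" by auto
      moreover have "{k, \<sigma> n} \<subseteq> {..<K}" using k \<sigma> n by auto
      ultimately show "card {T \<in> ?TT. {k, \<sigma> n} \<subseteq> T} = (if 2 \<le> t then (K - 2) choose (t - 2) else 0)"
        using card_supersets[of "{k, \<sigma> n}" K t] by presburger
    qed
    also have "\<dots> = (N - 1) * (if 2 \<le> t then (K - 2) choose (t - 2) else 0)"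
      using bN[OF k] by simp
    finally have cardC: "card C \<le> card {T \<in> ?TT. {k} \<subseteq> T} +
       (N - 1) * (if 2 \<le> t then (K - 2) choose (t - 2) else 0)" .
    have xC: "x n T \<in> fv.span (U \<union> C)" if n: "n < N" and T: "T \<in> ?TT" "k \<in> T"
      and or: "n = b k \<or> \<sigma> n \<in> T" for n T
    proof -
      have "(n, T) \<in> I" using n T or unfolding I_def by auto
      then have "x n T \<in> C" unfolding C_def by force
      then show ?thesis by (simp add: fv.span_base)
    qed
    have "star N K t k \<subseteq> fv.span (U \<union> C)"
    proof
      fix v assume "v \<in> star N K t k"
      then obtain n' T where v: "v = unit_vec (n', T)" "n' < N" and T: "T \<in> ?TT" "k \<in> T"
        unfolding star_def by auto
      define n where "n = \<pi> T n'"
      have n: "n < N" "v = x n T" using v \<pi>N unit_x by (auto simp: n_def)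
      show "v \<in> fv.span (U \<union> C)"
      proof (cases "n = b k \<or> \<sigma> n \<in> T")
        case True
        then show ?thesis using xC n T by simp
      next
        case False
        \<comment> \<open>Interference is eliminated by solving \<open>y n T\<close> for its leader
          term. Every other term retains \<open>\<sigma> n\<close>, and also \<open>k\<close> since
          \<open>k\<close> is no requester of \<open>n\<close>; so it lies in
          \<open>C\<close>.\<close>
        have "x n (insert (\<sigma> n) T - {\<sigma> n}) \<in> fv.span (U \<union> C)"
        proof (rule span_sum_remove[where f = "\<lambda>j. x n (insert (\<sigma> n) T - {j})", OF finA])
          show "(\<Sum>j\<in>insert (\<sigma> n) T \<inter> P n. x n (insert (\<sigma> n) T - {j})) \<in> fv.span (U \<union> C)"
            using yU[of n T] n T False unfolding y_def by (auto intro: fv.span_base)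
          fix j assume j: "j \<in> insert (\<sigma> n) T \<inter> P n - {\<sigma> n}"
          then have "j \<noteq> k" using False unfolding P_def by auto
          then show "x n (insert (\<sigma> n) T - {j}) \<in> fv.span (U \<union> C)"
            using j n T False \<sigma>[of n] by (intro xC t_subsets_exchange) auto
        qed (use \<sigma>P n in auto)
        then show ?thesis using False n by simp
      qed
    qed
    then show "\<exists>C. finite C \<and> card C \<le> card {T \<in> ?TT. {k} \<subseteq> T} +
        (N - 1) * (if 2 \<le> t then (K - 2) choose (t - 2) else 0) \<and>
        star N K t k \<subseteq> fv.span (U \<union> C)"
      using cardC finI unfolding C_def by blast
  next
    fix k T assume k: "k < K" and T: "T \<in> ?TT"
    let ?S = "fv.span (U \<union> star N K t k)"
    let ?n = "b k" and ?g = "d k"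
    have n: "?n < N" using bN k by simp
    have star: "x m S \<in> ?S" if "m < N" "S \<in> ?TT" "k \<in> S" for m S
      using x_star[OF that] by (simp add: fv.span_base)
    have y: "y m S \<in> ?S" if "m < N" "S \<in> ?TT" "\<sigma> m \<notin> S" for m S
      using yU[OF that] by (simp add: fv.span_base)
    \<comment> \<open>If \<open>k \<notin> S\<close>, swap the leader for \<open>k\<close> to get
      \<open>S'\<close>: in \<open>y (b k) S'\<close> the term for \<open>k\<close> has index set
      \<open>S\<close>, and all others contain \<open>k\<close>.\<close>
    have leader: "x ?n S \<in> ?S" if S: "S \<in> ?TT" "\<sigma> ?n \<in> S" for S
    proof (cases "k \<in> S")
      case True
      then show ?thesis using star n S by simp
    next
      case False
      define S' where "S' = insert k S - {\<sigma> ?n}"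
      have S': "S' \<in> ?TT" unfolding S'_def using k S False by (intro t_subsets_exchange) auto
      have ins: "insert (\<sigma> ?n) S' = insert k S" using S unfolding S'_def by auto
      have "x ?n (insert (\<sigma> ?n) S' - {k}) \<in> ?S"
      proof (rule span_sum_remove[where f = "\<lambda>j. x ?n (insert (\<sigma> ?n) S' - {j})", OF finA])
        show "k \<in> insert (\<sigma> ?n) S' \<inter> P ?n" using k unfolding ins P_def by simp
        show "(\<Sum>j\<in>insert (\<sigma> ?n) S' \<inter> P ?n. x ?n (insert (\<sigma> ?n) S' - {j})) \<in> ?S"
          using y[of ?n S'] n S' unfolding y_def by (simp add: S'_def)
        fix j assume j: "j \<in> insert (\<sigma> ?n) S' \<inter> P ?n - {k}"
        then show "x ?n (insert (\<sigma> ?n) S' - {j}) \<in> ?S"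
          unfolding ins using n S k False by (intro star t_subsets_exchange) auto
      qed
      then show ?thesis using False by (simp add: ins)
    qed
    \<comment> \<open>In \<open>y (b k) T\<close> all terms but the leader's contain the leader in
      their index set, hence are already decoded.\<close>
    have own: "x ?n T \<in> ?S"
    proof (cases "\<sigma> ?n \<in> T")
      case True
      then show ?thesis using leader T by simp
    next
      case False
      have "x ?n (insert (\<sigma> ?n) T - {\<sigma> ?n}) \<in> ?S"
      proof (rule span_sum_remove[where f = "\<lambda>j. x ?n (insert (\<sigma> ?n) T - {j})", OF finA])
        show "(\<Sum>j\<in>insert (\<sigma> ?n) T \<inter> P ?n. x ?n (insert (\<sigma> ?n) T - {j})) \<in> ?S"
          using y[of ?n T] n T False unfolding y_def by simp
        fix j assume "j \<in> insert (\<sigma> ?n) T \<inter> P ?n - {\<sigma> ?n}"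
        then show "x ?n (insert (\<sigma> ?n) T - {j}) \<in> ?S"
          using T False \<sigma>[OF n] by (intro leader t_subsets_exchange) auto
      qed (use \<sigma>P n in auto)
      then show ?thesis using False by simp
    qed
    have eq: "unit_vec (?g, T) = x (c ?g T) T"
      using unit_x[OF dN[OF k]] k by (simp add: \<pi>_def)
    \<comment> \<open>If there is a candidate, the wanted subfile was sent alone. Otherwise either
      \<open>k \<in> T\<close>, or \<open>b k = d k\<close>: a user with
      \<open>b k \<noteq> d k\<close> and \<open>k \<notin> T\<close> would make \<open>b k\<close>
      itself a candidate.\<close>
    show "unit_vec (d k, T) \<in> ?S"
    proof (cases "H ?g T = {}")
      case False
      define m where "m = c ?g T"
      have m: "m < N" "m \<notin> d ` {..<K}" "\<sigma> m \<notin> T"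
        using cH[OF False] unfolding m_def by auto
      have "y m T = x m T" using m P_missing[of m] unfolding y_def by simp
      then show ?thesis using y[of m T] m T eq by (simp add: m_def)
    next
      case True
      then have "c ?g T = ?g" by (rule c0)
      moreover have "?n = ?g" if "k \<notin> T"
      proof (rule ccontr)
        assume "?n \<noteq> ?g"
        then have "?n \<in> H ?g T" using that bd[OF k] n by (simp add: H_def)
        then show False using True by simp
      qed
      ultimately show ?thesis
        using eq own star dN[OF k] T by (cases "k \<in> T") auto
    qed
  qed (use finU cardU in auto)
qed

text \<open>\<open>fv.common_complement\<close>, indexed by the finitely many demands, replaces the
  sets \<open>C\<close> of each user by one set \<open>Z k\<close> that recovers its
  \<open>star\<close> whatever the demand.\<close>

lemma linear_scheme_exists:
  assumes "N \<le> K"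
  shows "\<exists>U Z. (\<forall>d\<in>demands N K. finite (U d) \<and> card (U d) \<le> N * ((K - 1) choose t)) \<and>
    (\<forall>k<K. finite (Z k) \<and> card (Z k) \<le> (if 1 \<le> t then (K - 1) choose (t - 1) else 0) +
            (N - 1) * (if 2 \<le> t then (K - 2) choose (t - 2) else 0)) \<and>
    (\<forall>d\<in>demands N K. \<forall>k<K. \<forall>T\<in>t_subsets K t. unit_vec (d k, T) \<in> fv.span (U d \<union> Z k))"
proof -
  let ?b = "(if 1 \<le> t then (K - 1) choose (t - 1) else 0) +
            (N - 1) * (if 2 \<le> t then (K - 2) choose (t - 2) else 0)"
  obtain U where U: "\<forall>d\<in>demands N K. finite (U d) \<and> card (U d) \<le> N * ((K - 1) choose t) \<and> (\<forall>k<K.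
     (\<exists>C. finite C \<and> card C \<le> card {T \<in> t_subsets K t. {k} \<subseteq> T} +
            (N - 1) * (if 2 \<le> t then (K - 2) choose (t - 2) else 0) \<and>
          star N K t k \<subseteq> fv.span (U d \<union> C)) \<and>
     (\<forall>T\<in>t_subsets K t. unit_vec (d k, T) \<in> fv.span (U d \<union> star N K t k)))"
    using bchoice[OF ballI[OF delivery_exists[OF _ assms, where t = t]]] ..
  have fin: "finite (demands N K)" unfolding demands_def by (intro finite_PiE) auto
  have "\<exists>Z. Z \<subseteq> fv.span (star N K t k) \<and> finite Z \<and> card Z \<le> ?b \<and>
      (\<forall>d\<in>demands N K. fv.span (star N K t k) \<subseteq> fv.span (U d \<union> Z))" if k: "k < K" for k
  proof (rule fv.common_complement[OF _ fin])
    show "infinite (UNIV :: rat set)" by (rule infinite_UNIV_char_0)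
    fix d assume d: "d \<in> demands N K"
    have "card {T \<in> t_subsets K t. {k} \<subseteq> T} = (if 1 \<le> t then (K - 1) choose (t - 1) else 0)"
      using k by (subst card_supersets) auto
    moreover have "\<exists>C. finite C \<and> card C \<le> card {T \<in> t_subsets K t. {k} \<subseteq> T} +
            (N - 1) * (if 2 \<le> t then (K - 2) choose (t - 2) else 0) \<and>
          star N K t k \<subseteq> fv.span (U d \<union> C)"
      using U d k by blast
    ultimately have "\<exists>C. finite C \<and> card C \<le> ?b \<and> star N K t k \<subseteq> fv.span (U d \<union> C)"
      by simp
    then show "\<exists>C. finite C \<and> card C \<le> ?b \<and> fv.span (star N K t k) \<subseteq> fv.span (U d \<union> C)"
      using fv.span_minimal[OF _ fv.subspace_span] by blast
  qed (rule fv.subspace_span)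
  then have "\<forall>k\<in>{..<K}. \<exists>Z. Z \<subseteq> fv.span (star N K t k) \<and> finite Z \<and> card Z \<le> ?b \<and>
      (\<forall>d\<in>demands N K. fv.span (star N K t k) \<subseteq> fv.span (U d \<union> Z))" by blast
  then obtain Z where Z: "\<And>k. k < K \<Longrightarrow> finite (Z k) \<and> card (Z k) \<le> ?b \<and>
      (\<forall>d\<in>demands N K. fv.span (star N K t k) \<subseteq> fv.span (U d \<union> Z k))"
    by (elim bchoice[THEN exE]) auto
  have "unit_vec (d k, T) \<in> fv.span (U d \<union> Z k)"
    if d: "d \<in> demands N K" and k: "k < K" and T: "T \<in> t_subsets K t" for d k T
  proof -
    have "U d \<union> star N K t k \<subseteq> fv.span (U d \<union> Z k)"
      using Z[OF k] d fv.span_superset[of "star N K t k"] fv.span_superset[of "U d \<union> Z k"] by blast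
    then have "fv.span (U d \<union> star N K t k) \<subseteq> fv.span (U d \<union> Z k)"
      by (rule fv.span_minimal) (rule fv.subspace_span)
    then show ?thesis using U d k T by blast
  qed
  then show ?thesis using U Z by (intro exI[of _ U] exI[of _ Z]) blast
qed

section \<open>Clearing denominators\<close>

lemma common_denominator:
  assumes "finite (S :: rat set)"
  shows "\<exists>D::int. D > 0 \<and> (\<forall>x\<in>S. of_int D * x \<in> \<int>)"
  using assms
proof (induction S rule: finite_induct)
  case empty
  then show ?case by (intro exI[of _ 1]) simp
next
  case (insert x S)
  then obtain D :: int where D: "D > 0" "\<forall>x\<in>S. of_int D * x \<in> \<int>" by blast
  obtain a b where x: "x = of_int a / of_int b" "b > 0"
    by (metis quotient_of_div quotient_of_denom_pos surj_pair)
  have "of_int (D * b) * x = of_int (D * a)" using x by simp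
  moreover have "of_int (D * b) * z \<in> \<int>" if "z \<in> S" for z
  proof -
    have "of_int (D * b) * z = of_int b * (of_int D * z)" by simp
    then show ?thesis using D that by (metis Ints_mult Ints_of_int)
  qed
  ultimately show ?case using D x by (intro exI[of _ "D * b"]) auto
qed

text \<open>Only finitely many coefficients occur, so one denominator serves all. The rational
  vectors remain as names of the transmitted and cached symbols, while \<open>ic\<close> holds their
  integer coefficients.\<close>

lemma integer_scheme_exists:
  assumes "N \<le> K"
  shows "\<exists>(D::int) (ic :: (nat \<times> nat set \<Rightarrow> rat) \<Rightarrow> nat \<times> nat set \<Rightarrow> int) U Z. D > 0 \<and>
    (\<forall>d\<in>demands N K. finite (U d) \<and> card (U d) \<le> N * ((K - 1) choose t)) \<and>
    (\<forall>k<K. finite (Z k) \<and> card (Z k) \<le> (if 1 \<le> t then (K - 1) choose (t - 1) else 0) +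
            (N - 1) * (if 2 \<le> t then (K - 2) choose (t - 2) else 0)) \<and>
    (\<forall>d\<in>demands N K. \<forall>k<K. \<forall>T\<in>t_subsets K t. \<exists>\<alpha> :: _ \<Rightarrow> int. \<forall>p\<in>{..<N} \<times> t_subsets K t.
       (\<Sum>v\<in>U d \<union> Z k. \<alpha> v * ic v p) = (if p = (d k, T) then D else 0))"
proof -
  obtain U Z where U: "\<forall>d\<in>demands N K. finite (U d) \<and> card (U d) \<le> N * ((K - 1) choose t)"
    and Z: "\<forall>k<K. finite (Z k) \<and> card (Z k) \<le> (if 1 \<le> t then (K - 1) choose (t - 1) else 0) +
            (N - 1) * (if 2 \<le> t then (K - 2) choose (t - 2) else 0)"
    and span: "\<forall>d\<in>demands N K. \<forall>k<K. \<forall>T\<in>t_subsets K t. unit_vec (d k, T) \<in> fv.span (U d \<union> Z k)"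
    using linear_scheme_exists[OF assms, of t] by blast
  define X where "X = (demands N K \<times> {..<K}) \<times> t_subsets K t"
  define I where "I = {..<N} \<times> t_subsets K t"
  have finX: "finite X" unfolding X_def demands_def by (intro finite_cartesian_product finite_PiE) auto
  have "\<exists>\<beta>. (\<Sum>v\<in>U (fst (fst y)) \<union> Z (snd (fst y)). scale_fun (\<beta> v) v)
      = unit_vec (fst (fst y) (snd (fst y)), snd y)" if y: "y \<in> X" for y
  proof -
    have "finite (U (fst (fst y)) \<union> Z (snd (fst y)))" using y U Z unfolding X_def by auto
    moreover have "unit_vec (fst (fst y) (snd (fst y)), snd y) \<in> fv.span (U (fst (fst y)) \<union> Z (snd (fst y)))"
      using y span unfolding X_def by auto
    ultimately have "unit_vec (fst (fst y) (snd (fst y)), snd y)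
        \<in> range (\<lambda>\<beta>. \<Sum>v\<in>U (fst (fst y)) \<union> Z (snd (fst y)). scale_fun (\<beta> v) v)"
      by (simp only: fv.span_finite)
    then show ?thesis by (rule rangeE) (rule exI, erule sym)
  qed
  from bchoice[OF ballI[OF this]] obtain \<beta> where \<beta>: "\<forall>y\<in>X.
      (\<Sum>v\<in>U (fst (fst y)) \<union> Z (snd (fst y)). scale_fun (\<beta> y v) v)
      = unit_vec (fst (fst y) (snd (fst y)), snd y)" ..
  define V where "V = (\<Union>y\<in>X. U (fst (fst y)) \<union> Z (snd (fst y)))"
  have finV: "finite V" unfolding V_def using finX U Z by (auto simp: X_def)
  have finI: "finite I" unfolding I_def by simp
  have "finite ((\<lambda>(v, p). v p) ` (V \<times> I) \<union> (\<lambda>(y, v). \<beta> y v) ` (X \<times> V))"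
    using finV finI finX by blast
  then obtain D :: int where D: "D > 0"
    "\<forall>x\<in>(\<lambda>(v, p). v p) ` (V \<times> I) \<union> (\<lambda>(y, v). \<beta> y v) ` (X \<times> V). of_int D * x \<in> \<int>"
    using common_denominator by blast
  \<comment> \<open>The floor only changes the type: on \<open>V\<close> and \<open>I\<close> its
    argument is already an integer.\<close>
  define ic where "ic v p = \<lfloor>of_int D * v p\<rfloor>" for v :: "nat \<times> nat set \<Rightarrow> rat" and p
  have ic: "of_int (ic v p) = of_int D * v p" if "v \<in> V" "p \<in> I" for v p
  proof -
    have "of_int D * v p \<in> \<int>" using D(2) that by force
    then show ?thesis unfolding ic_def by (simp add: of_int_floor)
  qed
  have "\<exists>\<alpha> :: _ \<Rightarrow> int. \<forall>p\<in>I. (\<Sum>v\<in>U d \<union> Z k. \<alpha> v * ic v p) = (if p = (d k, T) then D * D else 0)"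
    if d: "d \<in> demands N K" and k: "k < K" and T: "T \<in> t_subsets K t" for d k T
  proof -
    define y where "y = ((d, k), T)"
    have y: "y \<in> X" using d k T unfolding y_def X_def by simp
    have sub: "U d \<union> Z k \<subseteq> V" using y unfolding V_def y_def by force
    define \<alpha> where "\<alpha> v = \<lfloor>of_int D * \<beta> y v\<rfloor>" for v
    have \<alpha>: "of_int (\<alpha> v) = of_int D * \<beta> y v" if "v \<in> V" for v
    proof -
      have "of_int D * \<beta> y v \<in> \<int>" using D(2) that y by force
      then show ?thesis unfolding \<alpha>_def by (simp add: of_int_floor)
    qed
    have "(\<Sum>v\<in>U d \<union> Z k. \<alpha> v * ic v p) = (if p = (d k, T) then D * D else 0)" if p: "p \<in> I" for p
    proof -
      have "of_int (\<Sum>v\<in>U d \<union> Z k. \<alpha> v * ic v p) = (\<Sum>v\<in>U d \<union> Z k. of_int (D * D) * (\<beta> y v * v p))"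
        unfolding of_int_sum
      proof (rule sum.cong)
        fix v assume "v \<in> U d \<union> Z k"
        then have "v \<in> V" using sub by blast
        then show "of_int (\<alpha> v * ic v p) = of_int (D * D) * (\<beta> y v * v p)"
          using \<alpha> ic[OF _ p] by simp
      qed simp
      also have "\<dots> = of_int (D * D) * (\<Sum>v\<in>U d \<union> Z k. \<beta> y v * v p)"
        by (simp only: sum_distrib_left)
      also have "(\<Sum>v\<in>U d \<union> Z k. \<beta> y v * v p) = (\<Sum>v\<in>U d \<union> Z k. scale_fun (\<beta> y v) v) p"
        by (simp only: sum_fun_apply scale_fun_def)
      also have "\<dots> = unit_vec (d k, T) p" using bspec[OF \<beta> y] by (simp add: y_def)
      also have "of_int (D * D) * unit_vec (d k, T) p
          = (of_int (if p = (d k, T) then D * D else 0) :: rat)" by (simp add: unit_vec_def)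
      finally show ?thesis by (simp only: of_int_eq_iff)
    qed
    then show ?thesis by blast
  qed
  \<comment> \<open>The factor is \<open>D * D\<close> because both the vectors and the decoding
    coefficients were scaled by \<open>D\<close>.\<close>
  then show ?thesis using U Z D(1) unfolding I_def
    by (intro exI[of _ "D * D"] exI[of _ ic] exI[of _ U] exI[of _ Z]) simp
qed

section \<open>From symbols modulo \<open>q\<close> to bit strings\<close>

text \<open>A number \<open>q\<close> congruent to 1 modulo \<open>D\<close> exists within
  \<open>D\<close> below \<open>x = 2 powr (F / s)\<close>. Bernoulli's inequality bounds the
  relative loss in the \<open>s\<close>-th power by \<open>s * D / x\<close>, which is at most
  \<open>\<epsilon>\<close> for large \<open>F\<close>.\<close>

lemma alphabet_size_exists:
  fixes D s :: nat and \<epsilon> :: real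
  assumes "D > 0" "s > 0" "\<epsilon> > 0"
  shows "\<exists>F0. \<forall>F\<ge>F0. \<exists>q::nat. q > 0 \<and> coprime q D \<and> real q \<le> 2 powr (real F / real s) \<and>
    (1 - \<epsilon>) * 2 ^ F \<le> real q ^ s"
proof -
  \<comment> \<open>A lower bound for \<open>x\<close>: at least \<open>s * D / \<epsilon>\<close>
    for the loss, and at least \<open>D\<close> so that \<open>- D / x\<close> is admissible in
    Bernoulli's inequality.\<close>
  define X where "X = max 1 (real s * real D / \<epsilon>) + real D"
  show ?thesis
  proof (rule exI[of _ "nat \<lceil>real s * log 2 X\<rceil>"], intro allI impI)
    fix F :: nat assume F: "F \<ge> nat \<lceil>real s * log 2 X\<rceil>"
    define x where "x = 2 powr (real F / real s)"
    have X: "X \<ge> 1" "X \<ge> real D" "X \<ge> real s * real D / \<epsilon>" unfolding X_def by auto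
    have "log 2 X \<le> real F / real s" using F assms by (simp add: field_simps)
    then have xX: "x \<ge> X" unfolding x_def using X by (simp add: log_le_iff)
    have xs: "x ^ s = 2 ^ F" unfolding x_def using assms
      by (simp add: powr_powr flip: powr_realpow)
    define y where "y = nat \<lfloor>x\<rfloor>"
    \<comment> \<open>The largest number up to \<open>y\<close> that is 1 modulo
      \<open>D\<close>.\<close>
    define q where "q = D * ((y - 1) div D) + 1"
    have y: "y \<ge> 1" "real y \<le> x" "x < real y + 1" unfolding y_def using xX X by linarith+
    have "D * ((y - 1) div D) + (y - 1) mod D = y - 1" by simp
    moreover have "(y - 1) mod D < D" using assms by simp
    ultimately have qy: "q \<le> y" "y < q + D" unfolding q_def using y by linarith+
    have qx: "real q \<le> x" using qy y by linarith
    have qx2: "x - real D \<le> real q" using qy y by linarith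
    have "(1 - \<epsilon>) * x ^ s \<le> real q ^ s"
    proof -
      have x0: "x > 0" using xX X by linarith
      have "real s * real D / \<epsilon> \<le> x" using xX X(3) by linarith
      then have "real s * real D \<le> \<epsilon> * x" using assms by (simp add: pos_divide_le_eq mult.commute)
      then have "1 - \<epsilon> \<le> 1 + real s * (- (real D / x))" using x0 by (simp add: field_simps)
      also have "\<dots> \<le> (1 + - (real D / x)) ^ s"
        using xX X x0 by (intro Bernoulli_inequality) (simp add: field_simps)
      also have "\<dots> \<le> (real q / x) ^ s"
      proof (rule power_mono)
        have "(x - real D) / x \<le> real q / x" using qx2 x0 by (intro divide_right_mono) auto
        then show "1 + - (real D / x) \<le> real q / x" using x0 by (simp add: diff_divide_distrib)
        show "0 \<le> 1 + - (real D / x)" using xX X x0 by simp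
      qed
      finally show ?thesis using x0 by (simp add: power_divide field_simps)
    qed
    moreover have "coprime q D"
    proof (rule coprimeI)
      fix c assume "c dvd q" "c dvd D"
      moreover from \<open>c dvd D\<close> have "c dvd D * ((y - 1) div D)" by simp
      ultimately show "is_unit c" unfolding q_def using dvd_add_right_iff by blast
    qed
    ultimately show "\<exists>q::nat. q > 0 \<and> coprime q D \<and> real q \<le> 2 powr (real F / real s) \<and>
      (1 - \<epsilon>) * 2 ^ F \<le> real q ^ s"
      using qx unfolding xs by (intro exI[of _ q]) (simp add: q_def x_def)
  qed
qed

text \<open>Contents may be any bit string of length at most \<open>m\<close>, so there are \<open>2 ^ (m + 1) - 1\<close> of
  them; this absorbs the loss in rounding the memory and the rate down.\<close>

lemma short_strings_injection:
  fixes c s F q :: nat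
  assumes "finite V" "card V \<le> c" "q > 0" and q: "real q \<le> 2 powr (real F / real s)"
  shows "\<exists>f :: ('v \<Rightarrow> int) \<Rightarrow> bool list. inj_on f (V \<rightarrow>\<^sub>E {0..<int q}) \<and>
    (\<forall>w\<in>V \<rightarrow>\<^sub>E {0..<int q}. real (length (f w)) \<le> of_int \<lfloor>real c / real s * real F\<rfloor>)"
proof -
  define m where "m = nat \<lfloor>real c / real s * real F\<rfloor>"
  have m0: "\<lfloor>real c / real s * real F\<rfloor> \<ge> 0" by simp
  define L where "L = {xs :: bool list. set xs \<subseteq> UNIV \<and> length xs \<le> m}"
  have "card L = 2 ^ (m + 1) - 1"
  proof -
    have "card L = (\<Sum>i\<le>m. 2 ^ i)" unfolding L_def by (subst card_lists_length_le) auto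
    also have "\<dots> = 2 ^ (m + 1) - 1" by (induction m) auto
    finally show ?thesis .
  qed
  \<comment> \<open>Strictness matters: it gives \<open>q ^ c \<le> 2 ^ (m + 1) - 1\<close>, exactly
    the number of available strings.\<close>
  moreover have "q ^ c < 2 ^ (m + 1)"
  proof -
    have "real q ^ c \<le> (2 powr (real F / real s)) ^ c" using q by (intro power_mono) auto
    also have "\<dots> = 2 powr (real c / real s * real F)"
      by (simp add: powr_powr flip: powr_realpow) (simp add: mult.commute)
    also have "\<dots> < 2 powr (real (m + 1))"
      using m0 unfolding m_def by (intro powr_less_mono) linarith+
    also have "\<dots> = 2 ^ (m + 1)" by (subst powr_realpow) auto
    finally have "real (q ^ c) < real (2 ^ (m + 1))" by simp
    then show ?thesis by (simp only: of_nat_less_iff)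
  qed
  moreover have "card (V \<rightarrow>\<^sub>E {0..<int q}) = q ^ card V"
    using assms by (simp add: card_PiE)
  moreover have "q ^ card V \<le> q ^ c" using assms by (intro power_increasing) auto
  ultimately have le: "card (V \<rightarrow>\<^sub>E {0..<int q}) \<le> card L" by linarith
  have "finite L" unfolding L_def by (rule finite_lists_length_le) simp
  moreover have "finite (V \<rightarrow>\<^sub>E {0..<int q})" using assms by (intro finite_PiE) auto
  ultimately obtain f where f: "f ` (V \<rightarrow>\<^sub>E {0..<int q}) \<subseteq> L" "inj_on f (V \<rightarrow>\<^sub>E {0..<int q})"
    using card_le_inj[OF _ _ le] by blast
  have "real (length (f w)) \<le> of_int \<lfloor>real c / real s * real F\<rfloor>" if "w \<in> V \<rightarrow>\<^sub>E {0..<int q}" for w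
  proof -
    have "length (f w) \<le> m" using f that unfolding L_def by blast
    then show ?thesis using m0 unfolding m_def by linarith
  qed
  then show ?thesis using f by blast
qed

text \<open>Caches and broadcasts hold the linear forms \<open>ic v\<close> modulo \<open>q\<close>,
  packed injectively into short strings. The decoder unpacks them, combines them with
  \<open>\<alpha>\<close> and divides by \<open>D\<close>. An error requires that the requested file
  lies outside the image of the symbol encoding.\<close>

lemma integer_scheme_achievable:
  fixes U :: "(nat \<Rightarrow> nat) \<Rightarrow> 'v set" and Z :: "nat \<Rightarrow> 'v set"
    and ic :: "'v \<Rightarrow> nat \<times> 'i \<Rightarrow> int" and TT :: "'i set" and D :: int
  assumes TT: "finite TT" "TT \<noteq> {}" and D: "D > 0"
    and U: "\<forall>d\<in>demands N K. finite (U d) \<and> card (U d) \<le> a"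
    and Z: "\<forall>k<K. finite (Z k) \<and> card (Z k) \<le> b"
    and dec: "\<forall>d\<in>demands N K. \<forall>k<K. \<forall>T\<in>TT. \<exists>\<alpha> :: 'v \<Rightarrow> int. \<forall>p\<in>{..<N} \<times> TT.
       (\<Sum>v\<in>U d \<union> Z k. \<alpha> v * ic v p) = (if p = (d k, T) then D else 0)"
  shows "achievable N K (real b / real (card TT)) (real a / real (card TT))"
  unfolding achievable_def
proof (intro allI impI)
  fix \<epsilon> :: real assume \<epsilon>: "\<epsilon> > 0"
  define s where "s = card TT"
  have s: "s > 0" using TT unfolding s_def by (simp add: card_gt_0_iff)
  define I where "I = {..<N} \<times> TT"
  have finI: "finite I" unfolding I_def using TT by simp
  define \<alpha> where "\<alpha> d k T = (SOME \<alpha> :: 'v \<Rightarrow> int. \<forall>p\<in>I.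
       (\<Sum>v\<in>U d \<union> Z k. \<alpha> v * ic v p) = (if p = (d k, T) then D else 0))" for d k T
  have \<alpha>: "(\<Sum>v\<in>U d \<union> Z k. \<alpha> d k T v * ic v p) = (if p = (d k, T) then D else 0)"
    if "d \<in> demands N K" "k < K" "T \<in> TT" "p \<in> I" for d k T p
  proof -
    have "\<exists>\<alpha> :: 'v \<Rightarrow> int. \<forall>p\<in>I. (\<Sum>v\<in>U d \<union> Z k. \<alpha> v * ic v p) = (if p = (d k, T) then D else 0)"
      using dec that unfolding I_def by blast
    from someI_ex[OF this] show ?thesis using that unfolding \<alpha>_def by blast
  qed
  obtain F0 where F0: "\<forall>F\<ge>F0. \<exists>q::nat. q > 0 \<and> coprime q (nat D) \<and>
      real q \<le> 2 powr (real F / real s) \<and> (1 - \<epsilon>) * 2 ^ F \<le> real q ^ s"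
    using alphabet_size_exists[of "nat D" s \<epsilon>] D s \<epsilon> by auto
  show "\<exists>F0. \<forall>F\<ge>F0. \<exists>phi psi mu. caching_scheme N K F (real b / real (card TT)) (real a / real (card TT)) phi psi mu \<and>
        (\<forall>d\<in>demands N K. \<forall>k<K. error_prob N F phi psi mu d k \<le> \<epsilon>)"
  proof (intro exI[of _ F0] allI impI)
    fix F assume "F \<ge> F0"
    then obtain q :: nat where q: "q > 0" "coprime q (nat D)" "real q \<le> 2 powr (real F / real s)"
      and q\<epsilon>: "(1 - \<epsilon>) * 2 ^ F \<le> real q ^ s" using F0 by blast
    have "coprime D (int q)" using q(2) D by (metis coprime_commute coprime_int_iff int_nat_eq order_less_imp_le)
    \<comment> \<open>\<open>E\<close> inverts \<open>D\<close> modulo \<open>q\<close>, which turns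
      \<open>D\<close> times a wanted symbol into the symbol.\<close>
    then obtain E where E: "[D * E = 1] (mod int q)" using cong_solve_coprime_int by blast
    define L where "L = {xs :: bool list. length xs = F}"
    have L: "finite L" "card L = 2 ^ F"
      using card_lists_length_eq[of "UNIV :: bool set" F] finite_lists_length_eq[of "UNIV :: bool set" F]
      unfolding L_def by auto
    define A where "A = TT \<rightarrow>\<^sub>E {0..<int q}"
    have finA: "finite A" unfolding A_def using TT by (intro finite_PiE) auto
    have cardA: "card A = q ^ s" unfolding A_def s_def using TT by (simp add: card_PiE)
    have "real q ^ s \<le> (2 powr (real F / real s)) ^ s" using q by (intro power_mono) auto
    also have "\<dots> = real (2 ^ F)" using s by (simp add: powr_powr flip: powr_realpow)
    finally have qL: "q ^ s \<le> 2 ^ F" by (simp only: of_nat_le_iff flip: of_nat_power)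
    then obtain j where j: "j ` A \<subseteq> L" "inj_on j A"
      using card_le_inj[OF finA L(1)] cardA L(2) by auto
    have "\<forall>k\<in>{..<K}. \<exists>f :: ('v \<Rightarrow> int) \<Rightarrow> bool list. inj_on f (Z k \<rightarrow>\<^sub>E {0..<int q}) \<and>
      (\<forall>w\<in>Z k \<rightarrow>\<^sub>E {0..<int q}. real (length (f w)) \<le> of_int \<lfloor>real b / real s * real F\<rfloor>)"
      using short_strings_injection[OF _ _ q(1,3)] Z by blast
    from bchoice[OF this] obtain fZ :: "nat \<Rightarrow> ('v \<Rightarrow> int) \<Rightarrow> bool list" where
      fZ: "\<And>k. k < K \<Longrightarrow> inj_on (fZ k) (Z k \<rightarrow>\<^sub>E {0..<int q})"
      "\<And>k w. k < K \<Longrightarrow> w \<in> Z k \<rightarrow>\<^sub>E {0..<int q} \<Longrightarrow> real (length (fZ k w)) \<le> of_int \<lfloor>real b / real s * real F\<rfloor>"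
      by blast
    have "\<forall>d\<in>demands N K. \<exists>f :: ('v \<Rightarrow> int) \<Rightarrow> bool list. inj_on f (U d \<rightarrow>\<^sub>E {0..<int q}) \<and>
      (\<forall>w\<in>U d \<rightarrow>\<^sub>E {0..<int q}. real (length (f w)) \<le> of_int \<lfloor>real a / real s * real F\<rfloor>)"
      using short_strings_injection[OF _ _ q(1,3)] U by blast
    from bchoice[OF this] obtain fU :: "(nat \<Rightarrow> nat) \<Rightarrow> ('v \<Rightarrow> int) \<Rightarrow> bool list" where
      fU: "\<And>d. d \<in> demands N K \<Longrightarrow> inj_on (fU d) (U d \<rightarrow>\<^sub>E {0..<int q})"
      "\<And>d w. d \<in> demands N K \<Longrightarrow> w \<in> U d \<rightarrow>\<^sub>E {0..<int q} \<Longrightarrow>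
         real (length (fU d w)) \<le> of_int \<lfloor>real a / real s * real F\<rfloor>"
      by blast
    define sym where "sym W p = inv_into A j (W (fst p)) (snd p)" for W :: "nat \<Rightarrow> bool list" and p
    define val where "val W v = (\<Sum>p\<in>I. ic v p * sym W p) mod int q" for W v
    define phi where "phi k W = fZ k (restrict (val W) (Z k))" for k W
    define psi where "psi d W = fU d (restrict (val W) (U d))" for d W
    \<comment> \<open>A form in both \<open>U d\<close> and \<open>Z k\<close> is read from the
      broadcast; the cache would give the same value.\<close>
    define mu where "mu d k X Y = j (\<lambda>T\<in>TT. (E * (\<Sum>v\<in>U d \<union> Z k. \<alpha> d k T v *
        (if v \<in> U d then inv_into (U d \<rightarrow>\<^sub>E {0..<int q}) (fU d) X v
         else inv_into (Z k \<rightarrow>\<^sub>E {0..<int q}) (fZ k) Y v))) mod int q)" for d k X Y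
    have val: "restrict (val W) S \<in> S \<rightarrow>\<^sub>E {0..<int q}" for W S
      using q(1) unfolding val_def by auto
    have scheme: "caching_scheme N K F (real b / real (card TT)) (real a / real (card TT)) phi psi mu"
      unfolding caching_scheme_def phi_def psi_def
      using fZ(2)[OF _ val] fU(2)[OF _ val] by (simp add: s_def)
    have correct: "mu d k (psi d W) (phi k W) = W (d k)"
      if d: "d \<in> demands N K" and k: "k < K" and W: "W (d k) \<in> j ` A" for d k W
    proof -
      have dk: "d k < N" using d k unfolding demands_def by auto
      define u where "u = inv_into A j (W (d k))"
      have u: "u \<in> A" "j u = W (d k)"
        using inv_into_into[OF W] f_inv_into_f[OF W] unfolding u_def by auto
      have iU: "inv_into (U d \<rightarrow>\<^sub>E {0..<int q}) (fU d) (psi d W) = restrict (val W) (U d)"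
        unfolding psi_def by (rule inv_into_f_f[OF fU(1)[OF d] val])
      have iZ: "inv_into (Z k \<rightarrow>\<^sub>E {0..<int q}) (fZ k) (phi k W) = restrict (val W) (Z k)"
        unfolding phi_def by (rule inv_into_f_f[OF fZ(1)[OF k] val])
      have "(E * (\<Sum>v\<in>U d \<union> Z k. \<alpha> d k T v *
        (if v \<in> U d then restrict (val W) (U d) v else restrict (val W) (Z k) v))) mod int q = u T"
        if T: "T \<in> TT" for T
      proof -
        have "(\<Sum>v\<in>U d \<union> Z k. \<alpha> d k T v *
            (if v \<in> U d then restrict (val W) (U d) v else restrict (val W) (Z k) v))
          = (\<Sum>v\<in>U d \<union> Z k. \<alpha> d k T v * val W v)"
          by (rule sum.cong) auto
        also have "[\<dots> = (\<Sum>v\<in>U d \<union> Z k. \<alpha> d k T v * (\<Sum>p\<in>I. ic v p * sym W p))] (mod int q)"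
          unfolding val_def by (intro cong_sum cong_mult cong_refl) (simp add: cong_def)
        also have "(\<Sum>v\<in>U d \<union> Z k. \<alpha> d k T v * (\<Sum>p\<in>I. ic v p * sym W p))
          = (\<Sum>v\<in>U d \<union> Z k. \<Sum>p\<in>I. (\<alpha> d k T v * ic v p) * sym W p)"
          by (simp add: sum_distrib_left mult.assoc)
        also have "\<dots> = (\<Sum>p\<in>I. \<Sum>v\<in>U d \<union> Z k. (\<alpha> d k T v * ic v p) * sym W p)"
          by (rule sum.swap)
        also have "\<dots> = (\<Sum>p\<in>I. (\<Sum>v\<in>U d \<union> Z k. \<alpha> d k T v * ic v p) * sym W p)"
          by (simp only: sum_distrib_right)
        also have "\<dots> = (\<Sum>p\<in>I. if p = (d k, T) then D * sym W p else 0)"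
          by (rule sum.cong) (simp_all add: \<alpha>[OF d k T])
        also have "\<dots> = D * sym W (d k, T)"
          using finI T dk by (simp add: I_def)
        also have "sym W (d k, T) = u T" by (simp add: sym_def u_def)
        finally have c: "[(\<Sum>v\<in>U d \<union> Z k. \<alpha> d k T v *
            (if v \<in> U d then restrict (val W) (U d) v else restrict (val W) (Z k) v)) = D * u T] (mod int q)" .
        have "[E * (\<Sum>v\<in>U d \<union> Z k. \<alpha> d k T v *
            (if v \<in> U d then restrict (val W) (U d) v else restrict (val W) (Z k) v)) = E * (D * u T)] (mod int q)"
          by (rule cong_scalar_left[OF c])
        also have "E * (D * u T) = (D * E) * u T" by simp
        also have "[(D * E) * u T = 1 * u T] (mod int q)" by (rule cong_scalar_right[OF E])
        finally have "[E * (\<Sum>v\<in>U d \<union> Z k. \<alpha> d k T v *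
            (if v \<in> U d then restrict (val W) (U d) v else restrict (val W) (Z k) v)) = u T] (mod int q)"
          by simp
        moreover have "u T mod int q = u T" using u(1) T unfolding A_def by (auto dest: PiE_mem)
        ultimately show ?thesis by (simp add: cong_def)
      qed
      then have "(\<lambda>T\<in>TT. (E * (\<Sum>v\<in>U d \<union> Z k. \<alpha> d k T v *
        (if v \<in> U d then restrict (val W) (U d) v else restrict (val W) (Z k) v))) mod int q) = restrict u TT"
        by (rule restrict_ext)
      also have "restrict u TT = u" using u(1) unfolding A_def by (rule PiE_restrict)
      finally show ?thesis unfolding mu_def iU iZ using u(2) by simp
    qed
    have "error_prob N F phi psi mu d k \<le> \<epsilon>" if d: "d \<in> demands N K" and k: "k < K" for d k
    proof -
      have dk: "d k < N" using d k unfolding demands_def by auto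
      have ft: "file_tuples N F = {..<N} \<rightarrow>\<^sub>E L" unfolding file_tuples_def L_def ..
      \<comment> \<open>Only coordinate \<open>d k\<close> is constrained, so the other files cancel
        in the error probability and the ratio \<open>1 - q ^ s / 2 ^ F\<close> bounds it.\<close>
      let ?B = "Pi\<^sub>E {..<N} (\<lambda>i. if i = d k then L - j ` A else L)"
      have "{W \<in> file_tuples N F. mu d k (psi d W) (phi k W) \<noteq> W (d k)} \<subseteq> ?B"
      proof
        fix W assume "W \<in> {W \<in> file_tuples N F. mu d k (psi d W) (phi k W) \<noteq> W (d k)}"
        then have W: "W \<in> {..<N} \<rightarrow>\<^sub>E L" and "W (d k) \<notin> j ` A"
          using correct[OF d k, of W] unfolding ft by auto
        then show "W \<in> ?B" by (simp add: PiE_iff)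
      qed
      moreover have "finite ?B" using L by (intro finite_PiE) auto
      ultimately have "card {W \<in> file_tuples N F. mu d k (psi d W) (phi k W) \<noteq> W (d k)} \<le> card ?B"
        by (rule card_mono[rotated])
      also have "card ?B = (\<Prod>i<N. card (if i = d k then L - j ` A else L))"
        by (simp add: card_PiE)
      also have "\<dots> = card (L - j ` A) * (\<Prod>i\<in>{..<N} - {d k}. card (if i = d k then L - j ` A else L))"
        using dk by (subst prod.remove[of _ "d k"]) auto
      also have "(\<Prod>i\<in>{..<N} - {d k}. card (if i = d k then L - j ` A else L)) = (2 ^ F) ^ (N - 1)"
        using dk L by simp
      also have "card (L - j ` A) = 2 ^ F - q ^ s"
        using j finA L cardA by (simp add: card_Diff_subset card_image)
      finally have num: "card {W \<in> file_tuples N F. mu d k (psi d W) (phi k W) \<noteq> W (d k)}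
          \<le> (2 ^ F - q ^ s) * (2 ^ F) ^ (N - 1)" .
      have "card (file_tuples N F) = (2 ^ F) ^ N" unfolding ft using L by (simp add: card_PiE)
      also have "\<dots> = 2 ^ F * (2 ^ F) ^ (N - 1)" using dk by (cases N) auto
      finally have den: "card (file_tuples N F) = 2 ^ F * (2 ^ F) ^ (N - 1)" .
      have "real ((2 ^ F - q ^ s) * (2 ^ F) ^ (N - 1)) = (2 ^ F - real q ^ s) * (2 ^ F) ^ (N - 1)"
        using qL by (simp add: of_nat_diff)
      also have "\<dots> \<le> (\<epsilon> * 2 ^ F) * (2 ^ F) ^ (N - 1)"
        using q\<epsilon> by (intro mult_right_mono) (simp_all add: algebra_simps)
      finally have "real (card {W \<in> file_tuples N F. mu d k (psi d W) (phi k W) \<noteq> W (d k)})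
          \<le> \<epsilon> * real (card (file_tuples N F))"
        using of_nat_mono[OF num, where 'a = real] unfolding den
        by (simp only: of_nat_mult of_nat_power of_nat_numeral mult.assoc)
      moreover have "real (card (file_tuples N F)) > 0" unfolding den by simp
      ultimately show ?thesis unfolding error_prob_def by (simp add: field_simps)
    qed
    then show "\<exists>phi psi mu. caching_scheme N K F (real b / real (card TT)) (real a / real (card TT)) phi psi mu \<and>
        (\<forall>d\<in>demands N K. \<forall>k<K. error_prob N F phi psi mu d k \<le> \<epsilon>)"
      using scheme by blast
  qed
qed

section \<open>Binomial identities that turn symbol counts into the memory-rate pair\<close>

theorem theorem1:
  fixes N K t :: nat
  assumes "K \<ge> 2" and "N \<le> K" and "t \<le> K"
  shows "achievable N K
           (real t * ((real N - 1) * real t + real K - real N) / (real K * (real K - 1)))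
           (real N * (real K - real t) / real K)"
\<comment> \<open>Without files there are no demands, as \<open>K > 0\<close>, and empty caches do.
  The case is separate because natural subtraction in \<open>N - 1\<close> would differ from
  \<open>real N - 1\<close>.\<close>
proof (cases "N = 0")
  case True
  have d: "demands N K = {}"
    using True assms(1) unfolding demands_def by (simp add: PiE_eq_empty_iff) (metis lessThan_iff less_le_trans zero_less_numeral)
  define M where "M = real t * ((real N - 1) * real t + real K - real N) / (real K * (real K - 1))"
  have "0 \<le> M"
    using True assms unfolding M_def by (intro divide_nonneg_nonneg mult_nonneg_nonneg) auto
  then have "\<And>F. caching_scheme N K F M R (\<lambda>_ _. []) psi mu" for R psi mu
    unfolding caching_scheme_def d by simp
  then show ?thesis
    unfolding achievable_def d M_def[symmetric] by blast
next
  case False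
  define s where "s = K choose t"
  define c1 where "c1 = (if 1 \<le> t then (K - 1) choose (t - 1) else 0)"
  define c2 where "c2 = (if 2 \<le> t then (K - 2) choose (t - 2) else 0)"
  have s: "s > 0" using assms unfolding s_def by simp
  have c1: "real K * real c1 = real t * real s"
  proof (cases "t \<ge> 1")
    case True
    then have "K * c1 = t * s" using times_binomial_minus1_eq[of t K] by (simp add: c1_def s_def)
    then show ?thesis by (metis of_nat_mult)
  qed (simp add: c1_def)
  \<comment> \<open>The absorption identity again, one level down; for \<open>t = 0\<close> and
    \<open>t = 1\<close> both sides vanish.\<close>
  have c2: "(real K - 1) * real c2 = (real t - 1) * real c1"
  proof (cases "t \<ge> 2")
    case True
    then have "(K - 1) * c2 = (t - 1) * c1"
      using times_binomial_minus1_eq[of "t - 1" "K - 1"] by (simp add: c1_def c2_def numeral_2_eq_2)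
    then have "real (K - 1) * real c2 = real (t - 1) * real c1" by (metis of_nat_mult)
    then show ?thesis using True assms by (simp add: of_nat_diff)
  next
    case False
    then have "t = 0 \<or> t = 1" by auto
    then show ?thesis by (auto simp: c1_def c2_def)
  qed
  \<comment> \<open>A cache holds \<open>c1 + (N - 1) * c2\<close> symbols, each worth a fraction
    \<open>1 / s\<close> of a file; \<open>c2 / c1\<close> is \<open>(t - 1) / (K - 1)\<close> when
    \<open>c1\<close> is nonzero.\<close>
  have M: "real (c1 + (N - 1) * c2) / real s
    = real t * ((real N - 1) * real t + real K - real N) / (real K * (real K - 1))"
  proof -
    have K: "real K > 0" "real K - 1 > 0" using assms by auto
    have c1': "real c1 = real t * real s / real K" using c1 K by (simp add: field_simps)
    have c2': "real c2 = (real t - 1) * real c1 / (real K - 1)" using c2 K by (simp add: field_simps)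
    have "real (c1 + (N - 1) * c2) = real c1 + (real N - 1) * real c2"
      using False by (simp add: of_nat_diff)
    also have "\<dots> = real c1 * (1 + (real N - 1) * ((real t - 1) / (real K - 1)))"
      unfolding c2' by (simp add: algebra_simps)
    also note c1'
    also have "1 + (real N - 1) * ((real t - 1) / (real K - 1))
        = ((real N - 1) * real t + real K - real N) / (real K - 1)"
      using K by (simp add: field_simps)
    finally have "real (c1 + (N - 1) * c2) = real t * real s / real K *
        (((real N - 1) * real t + real K - real N) / (real K - 1))" .
    then show ?thesis using s by (simp only: times_divide_times_eq times_divide_eq_left divide_divide_eq_left) simp
  qed
  have R: "real (N * ((K - 1) choose t)) / real s = real N * (real K - real t) / real K"
  proof -
    have "real (K - t) * real s = real K * real ((K - 1) choose t)"
      using binomial_absorb_comp[of K t] unfolding s_def by (metis of_nat_mult)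
    then have "real ((K - 1) choose t) = (real K - real t) * real s / real K"
      using assms by (simp add: of_nat_diff field_simps)
    then show ?thesis using s by simp
  qed
  obtain D :: int and ic :: "(nat \<times> nat set \<Rightarrow> rat) \<Rightarrow> nat \<times> nat set \<Rightarrow> int" and U Z where
    D: "D > 0" and U: "\<forall>d\<in>demands N K. finite (U d) \<and> card (U d) \<le> N * ((K - 1) choose t)"
    and Z: "\<forall>k<K. finite (Z k) \<and> card (Z k) \<le> c1 + (N - 1) * c2"
    and dec: "\<forall>d\<in>demands N K. \<forall>k<K. \<forall>T\<in>t_subsets K t. \<exists>\<alpha> :: _ \<Rightarrow> int. \<forall>p\<in>{..<N} \<times> t_subsets K t.
       (\<Sum>v\<in>U d \<union> Z k. \<alpha> v * ic v p) = (if p = (d k, T) then D else 0)"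
    using integer_scheme_exists[OF assms(2), of t] unfolding c1_def c2_def by blast
  have "t_subsets K t \<noteq> {}" using s card_t_subsets[of K t] unfolding s_def by auto
  then have "achievable N K (real (c1 + (N - 1) * c2) / real (card (t_subsets K t)))
      (real (N * ((K - 1) choose t)) / real (card (t_subsets K t)))"
    by (rule integer_scheme_achievable[OF finite_t_subsets _ D U Z dec])
  then show ?thesis unfolding card_t_subsets s_def[symmetric] M R .
qed

end
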